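(* Let $p$ be a real number with $2<p\le 4$. Then the optimal Hardy--Littlewood constant for $2$-homogeneous polynomials on $\ell_p(\mathbb{R}^2)$ is $2^{2/p}$. That is, the smallest constant $C$ such that $$\left(|a|^{\frac{p}{p-2}}+|b|^{\frac{p}{p-2}}+|c|^{\frac{p}{p-2}}\right)^{\frac{p-2}{p}}\le C\,\|P\|$$ for every $2$-homogeneous polynomial $P:\ell_p(\mathbb{R}^2)\to\mathbb{R}$, $P(x,y)=ax^2+bxy+cy^2$ with $a,b,c\in\mathbb{R}$, is $C=2^{2/p}$.
   Context: $\ell_p(\mathbb{R}^2)$ denotes $\mathbb{R}^2$ with the norm $\|(x,y)\|_p=(|x|^p+|y|^p)^{1/p}$. For a $2$-homogeneous polynomial $P(x,y)=ax^2+bxy+cy^2$ with real coefficients, its norm is $\|P\|=\sup\{|P(x,y)| : (x,y)\in\mathbb{R}^2,\ |x|^p+|y|^p\le 1\}$. In the Hardy--Littlewood inequality for $2<p\le 4$ the exponent on the coefficients is $\frac{p}{p-2}$, and the coefficients are those of the monomials $x^2$, $xy$, $y^2$ (each monomial counted once). The optimal Hardy--Littlewood constant is the least constant $C$ for which the inequality holds for all such $P$. *)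

theory Defs
  imports "HOL-Analysis.Analysis"
begin

definition quad_poly :: "real \<Rightarrow> real \<Rightarrow> real \<Rightarrow> real \<times> real \<Rightarrow> real" where
  "quad_poly a b c = (\<lambda>(x, y). a * x\<^sup>2 + b * x * y + c * y\<^sup>2)"

text \<open>All uses of \<open>powr\<close> below have a nonnegative base and, for \<open>p > 2\<close>, a positive exponent,
  so the convention \<open>0 powr s = 0\<close> agrees with the usual power.\<close>

definition lp_unit_ball :: "real \<Rightarrow> (real \<times> real) set" where
  "lp_unit_ball p = {(x, y). \<bar>x\<bar> powr p + \<bar>y\<bar> powr p \<le> 1}"

definition lp_poly_norm :: "real \<Rightarrow> (real \<times> real \<Rightarrow> real) \<Rightarrow> real" where
  "lp_poly_norm p P = (SUP z\<in>lp_unit_ball p. \<bar>P z\<bar>)"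

definition hl_coeff_norm :: "real \<Rightarrow> real \<Rightarrow> real \<Rightarrow> real \<Rightarrow> real" where
  "hl_coeff_norm p a b c =
     (\<bar>a\<bar> powr (p / (p - 2)) + \<bar>b\<bar> powr (p / (p - 2)) + \<bar>c\<bar> powr (p / (p - 2)))
       powr ((p - 2) / p)"

definition hl_constant :: "real \<Rightarrow> real \<Rightarrow> bool" where
  "hl_constant p C \<longleftrightarrow>
     (\<forall>a b c. hl_coeff_norm p a b c \<le> C * lp_poly_norm p (quad_poly a b c))"

definition optimal_hl_constant :: "real \<Rightarrow> real \<Rightarrow> bool" where
  "optimal_hl_constant p C \<longleftrightarrow> hl_constant p C \<and> (\<forall>C'. hl_constant p C' \<longrightarrow> C \<le> C')"

text \<open>The supremum in \<^const>\<open>lp_poly_norm\<close> is a genuine one: the set is nonempty and bounded.\<close>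

lemma lp_unit_ball_nonempty: "p > 0 \<Longrightarrow> (0, 0) \<in> lp_unit_ball p"
  by (simp add: lp_unit_ball_def)

lemma abs_le_1_of_lp_unit_ball:
  assumes "p > 0" "(x, y) \<in> lp_unit_ball p"
  shows "\<bar>x\<bar> \<le> 1" "\<bar>y\<bar> \<le> 1"
proof -
  have *: "t \<le> 1" if "t powr p \<le> 1" "t \<ge> 0" for t :: real
  proof (rule ccontr)
    assume "\<not> t \<le> 1"
    then have "1 powr p < t powr p"
      using assms(1) by (intro powr_less_mono2) auto
    with that show False by simp
  qed
  have "\<bar>x\<bar> powr p + \<bar>y\<bar> powr p \<le> 1"
    using assms(2) by (simp add: lp_unit_ball_def)
  moreover have "\<bar>x\<bar> powr p \<ge> 0" "\<bar>y\<bar> powr p \<ge> 0" by simp_all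
  ultimately have "\<bar>x\<bar> powr p \<le> 1" "\<bar>y\<bar> powr p \<le> 1" by linarith+
  then show "\<bar>x\<bar> \<le> 1" "\<bar>y\<bar> \<le> 1" by (auto intro: *)
qed

lemma bdd_above_lp_poly_norm:
  assumes "p > 0"
  shows "bdd_above ((\<lambda>z. \<bar>quad_poly a b c z\<bar>) ` lp_unit_ball p)"
proof (rule bdd_aboveI2)
  fix z assume "z \<in> lp_unit_ball p"
  then obtain x y where z: "z = (x, y)" and "(x, y) \<in> lp_unit_ball p" by (cases z) auto
  with assms have x: "\<bar>x\<bar> \<le> 1" and y: "\<bar>y\<bar> \<le> 1"
    using abs_le_1_of_lp_unit_ball by blast+
  have le: "\<bar>k * s * t\<bar> \<le> \<bar>k\<bar>" if "\<bar>s\<bar> \<le> 1" "\<bar>t\<bar> \<le> 1" for k s t :: real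
    using mult_left_mono[OF mult_le_one[OF that(1) abs_ge_zero that(2)], of "\<bar>k\<bar>"]
    by (simp add: abs_mult mult.assoc)
  show "\<bar>quad_poly a b c z\<bar> \<le> \<bar>a\<bar> + \<bar>b\<bar> + \<bar>c\<bar>"
    using le[OF x x, of a] le[OF x y, of b] le[OF y y, of c]
    unfolding z quad_poly_def prod.case power2_eq_square mult.assoc by linarith
qed

end

theory Submission
  imports Defs
begin

text \<open>
  Put \<open>q = p / (p - 2)\<close>, so that \<open>q \<ge> 2\<close> exactly because \<open>p \<le> 4\<close>. The upper bound reduces to the
  Euclidean bound at \<open>p = 4\<close>. There, some point with \<open>x^4 + y^4 = 1\<close> satisfies
  \<open>P(x, y)^2 \<ge> (a^2 + b^2 + c^2) / 2\<close> (\<open>quad_form_large_on_l4_sphere\<close>). To see this, write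
  \<open>P = m (x^2 - y^2) + d (x^2 + y^2) + b x y\<close> with \<open>m = (a - c) / 2\<close> and \<open>d = (a + c) / 2\<close>. Since
  \<open>x^4 + y^4 = (x^2 - y^2)^2 + 2 (x y)^2\<close>, the pair \<open>(x^2 - y^2, sqrt 2 x y)\<close> runs through the whole
  Euclidean unit circle, so it can be aligned with \<open>(m, b / sqrt 2)\<close>; the remaining term only helps,
  as \<open>x^2 + y^2 \<ge> 1\<close>. Hence \<open>\<bar>P\<bar> \<ge> sqrt (m^2 + b^2 / 2) + \<bar>d\<bar>\<close>, and
  \<open>m^2 + b^2 / 2 + d^2 = (a^2 + b^2 + c^2) / 2\<close>.

  Two comparisons of norms carry this to all \<open>p\<close>. By concavity, the factor \<open>2 powr (1/4 - 1/p)\<close>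
  maps the \<open>\<ell>\<^sub>4\<close> sphere into the \<open>\<ell>\<^sub>p\<close> ball (\<open>scaled_l4_sphere_in_lp_unit_ball\<close>), which gives
  \<open>sqrt (a^2 + b^2 + c^2) \<le> 2 powr (2/p) * \<parallel>P\<parallel>\<close>. And the \<open>\<ell>\<^sub>q\<close> norm of the coefficients is at most
  their \<open>\<ell>\<^sub>2\<close> norm since \<open>q \<ge> 2\<close> (\<open>lq_norm_le_l2_norm\<close>).

  The constant is attained by \<open>P(x, y) = x y\<close>, whose coefficient norm is \<open>1\<close> and whose norm is
  \<open>2 powr (- 2/p)\<close> by the inequality of arithmetic and geometric means.
\<close>

text \<open>
  The point is the complex square root of \<open>k + \<i> sqrt 2 s\<close>, whose square has real part
  \<open>x^2 - y^2\<close> and imaginary part \<open>2 x y\<close>.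
\<close>

lemma l4_sphere_point_of_unit_circle:
  fixes k s :: real
  assumes "k\<^sup>2 + s\<^sup>2 = 1"
  obtains x y :: real
  where "x^4 + y^4 = 1" "x\<^sup>2 - y\<^sup>2 = k" "sqrt 2 * (x * y) = s" "1 \<le> x\<^sup>2 + y\<^sup>2"
proof -
  define z where "z = csqrt (Complex k (sqrt 2 * s))"
  define x y where "x = Re z" and "y = Im z"
  have sq: "z\<^sup>2 = Complex k (sqrt 2 * s)"
    by (simp add: z_def)
  have k: "x\<^sup>2 - y\<^sup>2 = k"
    using arg_cong[OF sq, of Re] by (simp add: x_def y_def Re_power2)
  have "sqrt 2 * (sqrt 2 * (x * y)) = sqrt 2 * s"
    using arg_cong[OF sq, of Im] by (simp add: x_def y_def Im_power2 flip: mult.assoc)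
  then have s: "sqrt 2 * (x * y) = s"
    by simp
  have "x^4 + y^4 = (x\<^sup>2 - y\<^sup>2)\<^sup>2 + 2 * (x * y)\<^sup>2"
    by algebra
  also have "\<dots> = k\<^sup>2 + s\<^sup>2"
    by (simp add: k flip: s) (simp add: power_mult_distrib)
  finally have one: "x^4 + y^4 = 1"
    using assms by simp
  have "(x\<^sup>2 + y\<^sup>2)\<^sup>2 = x^4 + y^4 + 2 * (x * y)\<^sup>2"
    by algebra
  then have "1\<^sup>2 \<le> (x\<^sup>2 + y\<^sup>2)\<^sup>2"
    by (simp add: one)
  then have "1 \<le> x\<^sup>2 + y\<^sup>2"
    by (rule power2_le_imp_le) simp
  with one k s show thesis by (rule that)
qed

lemma unit_vector_aligned:
  fixes u v :: real
  obtains k s :: real where "k\<^sup>2 + s\<^sup>2 = 1" "u * k + v * s = sqrt (u\<^sup>2 + v\<^sup>2)"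
proof (cases "u = 0 \<and> v = 0")
  case True
  then show thesis using that[of 1 0] by simp
next
  case False
  define R where "R = sqrt (u\<^sup>2 + v\<^sup>2)"
  have R2: "R\<^sup>2 = u\<^sup>2 + v\<^sup>2" and R: "R \<noteq> 0"
    using False by (auto simp: R_def sum_power2_eq_zero_iff)
  have "(u / R)\<^sup>2 + (v / R)\<^sup>2 = 1"
    using R by (simp add: power_divide R2[symmetric] flip: add_divide_distrib)
  moreover have "u * (u / R) + v * (v / R) = R"
    using R R2 by (simp add: field_simps power2_eq_square)
  ultimately show thesis
    using that[of "u / R" "v / R"] by (simp add: R_def)
qed

lemma quad_form_large_on_l4_sphere:
  fixes a b c :: real
  obtains x y :: real
  where "x^4 + y^4 = 1" "sqrt ((a\<^sup>2 + b\<^sup>2 + c\<^sup>2) / 2) \<le> \<bar>quad_poly a b c (x, y)\<bar>"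
proof -
  define m d e where "m = (a - c) / 2" and "d = (a + c) / 2"
    and "e = (if d \<ge> 0 then 1 else - 1 :: real)"
  define R where "R = sqrt (m\<^sup>2 + (b / sqrt 2)\<^sup>2)"
  obtain k s where ks: "k\<^sup>2 + s\<^sup>2 = 1" "m * k + b / sqrt 2 * s = R"
    unfolding R_def by (rule unit_vector_aligned)
  \<comment> \<open>The sign \<open>e\<close> lets the aligned part and the part with \<open>d\<close> add up instead of cancelling.\<close>
  have "(e * k)\<^sup>2 + (e * s)\<^sup>2 = 1"
    using ks(1) by (simp add: e_def)
  then obtain x y where xy: "x^4 + y^4 = 1" "x\<^sup>2 - y\<^sup>2 = e * k" "sqrt 2 * (x * y) = e * s"
      "1 \<le> x\<^sup>2 + y\<^sup>2"
    by (rule l4_sphere_point_of_unit_circle)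
  have "b * x * y = b / sqrt 2 * (sqrt 2 * (x * y))"
    by simp
  then have bxy: "b * x * y = b / sqrt 2 * (e * s)"
    by (simp only: xy(3))
  have "quad_poly a b c (x, y) = m * (x\<^sup>2 - y\<^sup>2) + b * x * y + d * (x\<^sup>2 + y\<^sup>2)"
    by (simp add: quad_poly_def m_def d_def field_simps)
  also have "\<dots> = e * (m * k + b / sqrt 2 * s) + d * (x\<^sup>2 + y\<^sup>2)"
    unfolding xy(2) bxy by (simp add: algebra_simps)
  also have "\<dots> = e * (R + \<bar>d\<bar> * (x\<^sup>2 + y\<^sup>2))"
    unfolding ks(2) by (simp add: e_def)
  finally have P: "\<bar>quad_poly a b c (x, y)\<bar> = R + \<bar>d\<bar> * (x\<^sup>2 + y\<^sup>2)"
    by (simp add: e_def R_def abs_mult)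
  have R0: "0 \<le> R"
    by (simp add: R_def)
  have "R\<^sup>2 = m\<^sup>2 + b\<^sup>2 / 2"
    by (simp add: R_def power_divide)
  then have "(a\<^sup>2 + b\<^sup>2 + c\<^sup>2) / 2 = R\<^sup>2 + d\<^sup>2"
    by (simp add: m_def d_def power2_eq_square field_simps)
  also have "\<dots> \<le> (R + \<bar>d\<bar>)\<^sup>2"
    using R0 by (simp add: power2_sum)
  finally have "sqrt ((a\<^sup>2 + b\<^sup>2 + c\<^sup>2) / 2) \<le> R + \<bar>d\<bar>"
    using R0 by (intro real_le_lsqrt) auto
  also have "\<dots> \<le> \<bar>quad_poly a b c (x, y)\<bar>"
    unfolding P using mult_left_mono[OF xy(4), of "\<bar>d\<bar>"] by simp
  finally show thesis using xy(1) that by blast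
qed

text \<open>
  The tangent of the concave function \<open>t powr (p/4)\<close> at \<open>t = 1/2\<close> lies above it, which is Young's
  inequality with second factor \<open>1/2\<close>; add the tangent bounds at \<open>t = x^4\<close> and at \<open>t = y^4\<close>.
\<close>

lemma scaled_l4_sphere_in_lp_unit_ball:
  fixes p x y :: real
  assumes p: "0 < p" "p \<le> 4" and xy: "x^4 + y^4 = 1"
  defines "l \<equiv> 2 powr (1/4 - 1/p)"
  shows "(l * x, l * y) \<in> lp_unit_ball p"
proof -
  have tangent: "\<bar>l * t\<bar> powr p \<le> p/4 * t^4 + (1 - p/4) / 2" for t :: real
  proof (cases "t = 0")
    case True
    then show ?thesis using p by simp
  next
    case False
    have "\<bar>l * t\<bar> powr p = \<bar>t\<bar> powr p * l powr p"
      by (simp add: l_def abs_mult powr_mult)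
    also have "\<bar>t\<bar> powr p = (t^4) powr (p/4)"
    proof -
      have "t^4 = \<bar>t\<bar> powr 4"
        using False by (simp add: powr_numeral)
      then show ?thesis by (simp only: powr_powr) simp
    qed
    also have "l powr p = (1/2) powr (1 - p/4)"
    proof -
      have "l powr p = 2 powr ((1/4 - 1/p) * p)"
        by (simp only: l_def powr_powr)
      also have "(1/4 - 1/p) * p = - (1 - p/4)"
        using p by (simp add: field_simps)
      finally show ?thesis
        by (simp only: powr_minus_divide powr_divide powr_one_eq_one)
    qed
    also have "(t^4) powr (p/4) * (1/2) powr (1 - p/4) \<le> p/4 * t^4 + (1 - p/4) * (1/2)"
      using p False by (intro Youngs_inequality_0) auto
    finally show ?thesis by simp
  qed
  have "p/4 * x^4 + p/4 * y^4 = p/4"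
    using xy by (simp flip: distrib_left)
  with tangent[of x] tangent[of y] have "\<bar>l * x\<bar> powr p + \<bar>l * y\<bar> powr p \<le> 1"
    by argo
  then show ?thesis by (simp add: lp_unit_ball_def)
qed

text \<open>
  With \<open>S\<close> the sum of squares, each \<open>\<bar>t\<bar> powr q\<close> is at most \<open>t^2 * S powr (q/2 - 1)\<close>; these bounds
  add up to \<open>S powr (q/2)\<close>.
\<close>

lemma lq_norm_le_l2_norm:
  fixes a b c q :: real
  assumes q: "2 \<le> q"
  shows "(\<bar>a\<bar> powr q + \<bar>b\<bar> powr q + \<bar>c\<bar> powr q) powr (1/q) \<le> sqrt (a\<^sup>2 + b\<^sup>2 + c\<^sup>2)"
proof -
  define S where "S = a\<^sup>2 + b\<^sup>2 + c\<^sup>2"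
  have S0: "0 \<le> S"
    by (simp add: S_def)
  have term_le: "\<bar>t\<bar> powr q \<le> t\<^sup>2 * S powr (q/2 - 1)" if "t\<^sup>2 \<le> S" for t
  proof (cases "t = 0")
    case False
    have "t\<^sup>2 = \<bar>t\<bar> powr 2"
      using False by (simp add: powr_numeral)
    then have "\<bar>t\<bar> powr q = (t\<^sup>2) powr (1 + (q/2 - 1))"
      by (simp only: powr_powr) simp
    also have "\<dots> = t\<^sup>2 * (t\<^sup>2) powr (q/2 - 1)"
      using False by (subst powr_add) simp
    also have "\<dots> \<le> t\<^sup>2 * S powr (q/2 - 1)"
      using that q by (intro mult_left_mono powr_mono2) auto
    finally show ?thesis .
  qed simp
  have "\<bar>a\<bar> powr q + \<bar>b\<bar> powr q + \<bar>c\<bar> powr q \<le> S * S powr (q/2 - 1)"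
    using term_le[of a] term_le[of b] term_le[of c] by (simp add: S_def algebra_simps)
  also have "\<dots> = S powr (q/2)"
  proof (cases "S = 0")
    case False
    then have "S * S powr (q/2 - 1) = S powr (1 + (q/2 - 1))"
      using S0 by (subst powr_add) simp
    then show ?thesis by simp
  qed simp
  finally have "(\<bar>a\<bar> powr q + \<bar>b\<bar> powr q + \<bar>c\<bar> powr q) powr (1/q) \<le> (S powr (q/2)) powr (1/q)"
    using q by (intro powr_mono2) auto
  also have "\<dots> = sqrt S"
    using q S0 by (simp add: powr_powr powr_half_sqrt)
  finally show ?thesis by (simp add: S_def)
qed

lemma abs_quad_poly_le_lp_poly_norm:
  assumes "p > 0" "z \<in> lp_unit_ball p"
  shows "\<bar>quad_poly a b c z\<bar> \<le> lp_poly_norm p (quad_poly a b c)"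
  unfolding lp_poly_norm_def using assms by (intro cSUP_upper bdd_above_lp_poly_norm)

lemma hl_constant_upper_bound:
  fixes p :: real
  assumes p: "2 < p" "p \<le> 4"
  shows "hl_constant p (2 powr (2 / p))"
  unfolding hl_constant_def
proof (intro allI)
  fix a b c :: real
  define S where "S = a\<^sup>2 + b\<^sup>2 + c\<^sup>2"
  define l where "l = 2 powr (1/4 - 1/p)"
  obtain x y where xy: "x^4 + y^4 = 1" and large: "sqrt (S / 2) \<le> \<bar>quad_poly a b c (x, y)\<bar>"
    unfolding S_def by (rule quad_form_large_on_l4_sphere)
  have l2: "2 powr (2 / p) * l\<^sup>2 = sqrt 2"
  proof -
    have "l\<^sup>2 = 2 powr (1/2 - 2/p)"
      by (simp add: l_def power2_eq_square flip: powr_add)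
    then have "2 powr (2 / p) * l\<^sup>2 = 2 powr (1/2)"
      by (simp flip: powr_add)
    then show ?thesis by (simp add: powr_half_sqrt)
  qed
  have "hl_coeff_norm p a b c \<le> sqrt S"
    using lq_norm_le_l2_norm[of "p / (p - 2)" a b c] p
    by (simp add: hl_coeff_norm_def S_def field_simps)
  also have "\<dots> = sqrt 2 * sqrt (S / 2)"
    by (simp add: real_sqrt_divide)
  also have "\<dots> \<le> 2 powr (2 / p) * (l\<^sup>2 * \<bar>quad_poly a b c (x, y)\<bar>)"
    using mult_left_mono[OF large, of "sqrt 2"] by (simp add: l2 flip: mult.assoc)
  also have "l\<^sup>2 * \<bar>quad_poly a b c (x, y)\<bar> = \<bar>l\<^sup>2 * quad_poly a b c (x, y)\<bar>"
    by (simp add: abs_mult)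
  also have "l\<^sup>2 * quad_poly a b c (x, y) = quad_poly a b c (l * x, l * y)"
    by (simp add: quad_poly_def power2_eq_square algebra_simps)
  also have "2 powr (2 / p) * \<bar>quad_poly a b c (l * x, l * y)\<bar>
      \<le> 2 powr (2 / p) * lp_poly_norm p (quad_poly a b c)"
    using p scaled_l4_sphere_in_lp_unit_ball[of p x y] xy unfolding l_def
    by (intro mult_left_mono abs_quad_poly_le_lp_poly_norm) auto
  finally show "hl_coeff_norm p a b c \<le> 2 powr (2 / p) * lp_poly_norm p (quad_poly a b c)" .
qed

lemma lp_poly_norm_product_le:
  assumes p: "0 < p"
  shows "lp_poly_norm p (quad_poly 0 1 0) \<le> 2 powr (- (2 / p))"
  unfolding lp_poly_norm_def
proof (rule cSUP_least)
  show "lp_unit_ball p \<noteq> {}"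
    using lp_unit_ball_nonempty[OF p] by blast
next
  fix z assume "z \<in> lp_unit_ball p"
  then obtain x y where z: "z = (x, y)" and "(x, y) \<in> lp_unit_ball p"
    by (cases z) auto
  then have le1: "\<bar>x\<bar> powr p + \<bar>y\<bar> powr p \<le> 1"
    by (simp add: lp_unit_ball_def)
  define X Y where "X = \<bar>x\<bar> powr p" and "Y = \<bar>y\<bar> powr p"
  have "4 * (X * Y) \<le> (X + Y)\<^sup>2"
    using zero_le_power2[of "X - Y"] by (simp add: power2_eq_square algebra_simps)
  also have "\<dots> \<le> 1"
    using le1 by (intro power_le_one) (auto simp: X_def Y_def)
  finally have "\<bar>x * y\<bar> powr p \<le> 1/4"
    by (simp add: X_def Y_def abs_mult powr_mult)
  then have "(\<bar>x * y\<bar> powr p) powr (1/p) \<le> (1/4) powr (1/p)"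
    using p by (intro powr_mono2) auto
  moreover have "(1/4 :: real) = 2 powr (- 2)"
    by (simp add: powr_minus powr_numeral)
  ultimately show "\<bar>quad_poly 0 1 0 z\<bar> \<le> 2 powr (- (2 / p))"
    using p by (simp add: z quad_poly_def powr_powr)
qed

theorem theorem1p1:
  fixes p :: real
  assumes "2 < p" and "p \<le> 4"
  shows "optimal_hl_constant p (2 powr (2 / p))"
  unfolding optimal_hl_constant_def
proof (intro conjI allI impI)
  show "hl_constant p (2 powr (2 / p))"
    using assms by (rule hl_constant_upper_bound)
next
  fix C assume C: "hl_constant p C"
  define N where "N = lp_poly_norm p (quad_poly 0 1 0)"
  have "hl_coeff_norm p 0 1 0 = 1"
    by (simp add: hl_coeff_norm_def)
  then have CN: "1 \<le> C * N"
    using C unfolding hl_constant_def N_def by metis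
  have "0 \<le> N"
    using abs_quad_poly_le_lp_poly_norm[of p "(0, 0)" 0 1 0] lp_unit_ball_nonempty[of p] assms
    by (simp add: N_def quad_poly_def)
  with CN have "0 \<le> C"
    by (smt (verit) mult_nonneg_nonneg mult_nonpos_nonneg)
  then have "C * N \<le> C * 2 powr (- (2 / p))"
    using lp_poly_norm_product_le[of p] assms unfolding N_def by (intro mult_left_mono) auto
  with CN have "1 \<le> C * 2 powr (- (2 / p))"
    by (rule order_trans)
  then show "2 powr (2 / p) \<le> C"
    by (simp add: powr_minus_divide)
qed

end
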